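(* There is a one-to-one correspondence between symplectic mock-Lie algebras and quadratic mock-pre-Lie algebras.
   Context: All vector spaces are finite-dimensional over an algebraically closed field $\mathbb K$ of characteristic $0$. A mock-Lie algebra $(\mathfrak g,\{\cdot,\cdot\}_{\mathfrak g})$ is a vector space $\mathfrak g$ with a symmetric bilinear map $\{\cdot,\cdot\}_{\mathfrak g}:\mathfrak g\otimes\mathfrak g\to\mathfrak g$ satisfying $\{x,\{y,z\}_{\mathfrak g}\}_{\mathfrak g}+\{y,\{z,x\}_{\mathfrak g}\}_{\mathfrak g}+\{z,\{x,y\}_{\mathfrak g}\}_{\mathfrak g}=0$ for all $x,y,z\in\mathfrak g$. A symplectic mock-Lie algebra is a mock-Lie algebra $(\mathfrak g,\{\cdot,\cdot\}_{\mathfrak g})$ endowed with a nondegenerate skew-symmetric bilinear form $\omega\in\wedge^2\mathfrak g^*$ satisfying $\omega(\{x,y\}_{\mathfrak g},z)+\omega(\{y,z\}_{\mathfrak g},x)+\omega(\{z,x\}_{\mathfrak g},y)=0$ for all $x,y,z\in\mathfrak g$. A mock-pre-Lie algebra $(\mathfrak g,\cdot_{\mathfrak g})$ is a vector space $\mathfrak g$ with a bilinear product $\cdot_{\mathfrak g}:\mathfrak g\otimes\mathfrak g\to\mathfrak g$ satisfying $(x\cdot_{\mathfrak g} y)\cdot_{\mathfrak g} z+x\cdot_{\mathfrak g}(y\cdot_{\mathfrak g} z)=-(y\cdot_{\mathfrak g} x)\cdot_{\mathfrak g} z-y\cdot_{\mathfrak g}(x\cdot_{\mathfrak g} z)$ for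 all $x,y,z\in\mathfrak g$. A quadratic mock-pre-Lie algebra $(\mathfrak g,\cdot_{\mathfrak g},\omega)$ is a mock-pre-Lie algebra $(\mathfrak g,\cdot_{\mathfrak g})$ equipped with a nondegenerate skew-symmetric bilinear form $\omega\in\wedge^2\mathfrak g^*$ satisfying $\omega(x\cdot_{\mathfrak g}y,z)=\omega(y,\{x,z\}_c)$ for all $x,y,z\in\mathfrak g$, where $\{x,z\}_c=x\cdot_{\mathfrak g}z+z\cdot_{\mathfrak g}x$. *)

theory Defs
  imports Complex_Main "HOL-Computational_Algebra.Polynomial"
begin

(* The underlying vector space is a whole type 'v with scalar multiplication scale;
   finite-dimensionality and the conditions on the field are imposed where needed. *)

definition (in vector_space) bilinear_product :: "('b \<Rightarrow> 'b \<Rightarrow> 'b) \<Rightarrow> bool" where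
  "bilinear_product m \<longleftrightarrow>
     (\<forall>x. Vector_Spaces.linear scale scale (\<lambda>y. m x y)) \<and>
     (\<forall>y. Vector_Spaces.linear scale scale (\<lambda>x. m x y))"

definition (in vector_space) bilinear_form :: "('b \<Rightarrow> 'b \<Rightarrow> 'a) \<Rightarrow> bool" where
  "bilinear_form \<omega> \<longleftrightarrow>
     (\<forall>x. Vector_Spaces.linear scale (*) (\<lambda>y. \<omega> x y)) \<and>
     (\<forall>y. Vector_Spaces.linear scale (*) (\<lambda>x. \<omega> x y))"

(* One-sided nondegeneracy suffices, since the form is skew-symmetric. *)
locale nondegenerate_skew_form = vector_space scale
  for scale :: "'k::field \<Rightarrow> 'v::ab_group_add \<Rightarrow> 'v" +
  fixes \<omega> :: "'v \<Rightarrow> 'v \<Rightarrow> 'k"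
  assumes form_bilinear: "bilinear_form \<omega>"
    and form_skew: "\<omega> x y = - \<omega> y x"
    and form_nondegenerate: "(\<And>y. \<omega> x y = 0) \<Longrightarrow> x = 0"

locale mock_Lie_algebra = vector_space scale
  for scale :: "'k::field \<Rightarrow> 'v::ab_group_add \<Rightarrow> 'v" +
  fixes bracket :: "'v \<Rightarrow> 'v \<Rightarrow> 'v"
  assumes bracket_bilinear: "bilinear_product bracket"
    and bracket_sym: "bracket x y = bracket y x"
    and bracket_Jacobi:
      "bracket x (bracket y z) + bracket y (bracket z x) + bracket z (bracket x y) = 0"

locale symplectic_mock_Lie_algebra =
  mock_Lie_algebra scale bracket + nondegenerate_skew_form scale \<omega>
  for scale :: "'k::field \<Rightarrow> 'v::ab_group_add \<Rightarrow> 'v"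
    and bracket :: "'v \<Rightarrow> 'v \<Rightarrow> 'v"
    and \<omega> :: "'v \<Rightarrow> 'v \<Rightarrow> 'k" +
  assumes symplectic:
    "\<omega> (bracket x y) z + \<omega> (bracket y z) x + \<omega> (bracket z x) y = 0"

locale mock_pre_Lie_algebra = vector_space scale
  for scale :: "'k::field \<Rightarrow> 'v::ab_group_add \<Rightarrow> 'v" +
  fixes prd :: "'v \<Rightarrow> 'v \<Rightarrow> 'v"
  assumes prd_bilinear: "bilinear_product prd"
    and mock_pre_Lie:
      "prd (prd x y) z + prd x (prd y z) = - prd (prd y x) z - prd y (prd x z)"

definition anticommutator :: "('v \<Rightarrow> 'v \<Rightarrow> 'v::plus) \<Rightarrow> 'v \<Rightarrow> 'v \<Rightarrow> 'v" where
  "anticommutator prd x y = prd x y + prd y x"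

locale quadratic_mock_pre_Lie_algebra =
  mock_pre_Lie_algebra scale prd + nondegenerate_skew_form scale \<omega>
  for scale :: "'k::field \<Rightarrow> 'v::ab_group_add \<Rightarrow> 'v"
    and prd :: "'v \<Rightarrow> 'v \<Rightarrow> 'v"
    and \<omega> :: "'v \<Rightarrow> 'v \<Rightarrow> 'k" +
  assumes quadratic: "\<omega> (prd x y) z = \<omega> y (anticommutator prd x z)"

end

theory Submission
  imports Defs
begin

text \<open>
  A nondegenerate form identifies the space with its dual, so
  \<open>\<omega> (x \<cdot> y) z = \<omega> y {x, z}\<close> determines a product from a bracket and a form.
  Pairing the mock-pre-Lie identity with a vector turns it into
  \<open>\<omega> z J = 0\<close>, where \<open>J\<close> is the Jacobi sum, and pairing
  \<open>x \<cdot> y + y \<cdot> x = {x, y}\<close> with a vector gives the symplectic identity.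
\<close>

text \<open>\<open>Vector_Spaces.linear\<close> also asserts that domain and codomain are vector
  spaces; the field acting on itself by multiplication supplies the latter.\<close>

lemma (in vector_space) linear_into_scalars_iff:
  "Vector_Spaces.linear scale (*) f \<longleftrightarrow>
     (\<forall>x y. f (x + y) = f x + f y) \<and> (\<forall>c x. f (scale c x) = c * f x)"
proof -
  interpret S: vector_space "(*) :: 'a \<Rightarrow> 'a \<Rightarrow> 'a"
    by unfold_locales (simp_all add: algebra_simps)
  show ?thesis
    by (auto simp: Vector_Spaces.linear_iff vector_space_axioms S.vector_space_axioms)
qed

lemma (in vector_space) bilinear_product_iff:
  "bilinear_product m \<longleftrightarrow>
     (\<forall>x y z. m x (y + z) = m x y + m x z) \<and> (\<forall>x y z. m (x + y) z = m x z + m y z) \<and>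
     (\<forall>c x y. m x (scale c y) = scale c (m x y)) \<and>
     (\<forall>c x y. m (scale c x) y = scale c (m x y))"
  unfolding bilinear_product_def
  by (auto simp: Vector_Spaces.linear_iff vector_space_axioms)

context nondegenerate_skew_form
begin

lemma form_add_left: "\<omega> (x + y) z = \<omega> x z + \<omega> y z"
  and form_add_right: "\<omega> x (y + z) = \<omega> x y + \<omega> x z"
  and form_scale_left: "\<omega> (scale c x) y = c * \<omega> x y"
  and form_scale_right: "\<omega> x (scale c y) = c * \<omega> x y"
  using form_bilinear unfolding bilinear_form_def linear_into_scalars_iff by auto

lemma form_zero_left [simp]: "\<omega> 0 y = 0"
  using form_scale_left [of 0 0 y] by simp

lemma form_zero_right [simp]: "\<omega> x 0 = 0"
  using form_scale_right [of x 0 0] by simp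

lemma form_minus_left: "\<omega> (- x) y = - \<omega> x y"
  using form_scale_left [of "-1" x y] by simp

lemma form_diff_left: "\<omega> (x - y) z = \<omega> x z - \<omega> y z"
  using form_add_left [of x "- y" z] by (simp add: form_minus_left)

lemma eq_if_form_eq_left: "(\<And>z. \<omega> x z = \<omega> y z) \<Longrightarrow> x = y"
  using form_nondegenerate [of "x - y"] by (simp add: form_diff_left)

lemma zero_if_form_zero_right: "(\<And>z. \<omega> z x = 0) \<Longrightarrow> x = 0"
  by (rule form_nondegenerate) (simp add: form_skew [of x])

text \<open>Nondegeneracy makes v \<mapsto> \<open>\<omega> v\<close> injective; finite dimension
  then makes it surjective onto the dual.\<close>

lemma linear_functional_represented:
  assumes "finite_dimensional_vector_space scale Basis"
    and f: "Vector_Spaces.linear scale (*) f"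
  obtains v where "\<And>z. \<omega> v z = f z"
proof -
  interpret finite_dimensional_vector_space scale Basis by fact
  have f_add: "f (x + y) = f x + f y" and f_scale: "f (scale c x) = c * f x" for c x y
    using f unfolding linear_into_scalars_iff by auto
  have f0: "f 0 = 0" using f_scale [of 0 0] by simp
  have coeff_eq: "\<forall>b\<in>Basis. g b = h b"
    if "(\<Sum>b\<in>Basis. scale (g b) b) = (\<Sum>b\<in>Basis. scale (h b) b)" for g h
  proof
    fix b assume "b \<in> Basis"
    have "(\<Sum>b\<in>Basis. scale (g b - h b) b) = 0"
      using that by (simp add: scale_left_diff_distrib sum_subtractf)
    then have "g b - h b = 0"
      using \<open>b \<in> Basis\<close>
      by (rule independentD [OF independent_Basis finite_Basis subset_refl])
    then show "g b = h b" by simp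
  qed
  \<comment> \<open>Stated for a general linear \<open>g\<close> because it serves twice: with
    another functional \<open>\<omega> v\<close> for injectivity, and with \<open>f\<close> at the
    end.\<close>
  have agree: "\<omega> v z = g z"
    if "\<forall>b\<in>Basis. \<omega> v b = g b" and "g 0 = 0"
      and "\<And>x y. g (x + y) = g x + g y" and "\<And>c x. g (scale c x) = c * g x" for v g z
  proof -
    have "z \<in> span Basis" by (simp add: span_Basis)
    then show ?thesis
      by (induction rule: span_induct_alt)
        (use that in \<open>auto simp: form_add_right form_scale_right\<close>)
  qed
  \<comment> \<open>The functional \<open>\<omega> v\<close> is encoded by the vector whose
    coordinates are its values on the basis. This makes \<open>T\<close> an endomorphism, for which
    injective implies surjective, and avoids the dual space.\<close>
  define T where "T v = (\<Sum>b\<in>Basis. scale (\<omega> v b) b)" for v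
  have T_linear: "Vector_Spaces.linear scale scale T"
    unfolding Vector_Spaces.linear_iff T_def
    by (simp add: vector_space_axioms form_add_left form_scale_left scale_left_distrib
        sum.distrib scale_sum_right)
  have "inj T"
  proof (rule injI)
    fix u v assume "T u = T v"
    then have "\<forall>b\<in>Basis. \<omega> u b = \<omega> v b"
      unfolding T_def by (rule coeff_eq)
    then have "\<omega> u z = \<omega> v z" for z
      by (rule agree) (simp_all add: form_add_right form_scale_right)
    then show "u = v" by (rule eq_if_form_eq_left)
  qed
  with T_linear have "surj T" by (rule linear_inj_imp_surj)
  then obtain v where "T v = (\<Sum>b\<in>Basis. scale (f b) b)" by (metis surjD)
  then have "\<forall>b\<in>Basis. \<omega> v b = f b"
    unfolding T_def by (rule coeff_eq)
  then have "\<omega> v z = f z" for z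
    by (rule agree) (simp_all add: f0 f_add f_scale)
  then show thesis by (rule that)
qed

end

text \<open>By \<open>quadratic\<close>, left multiplication by x is \<omega>-adjoint to bracketing
  with x, so products in the first slot become nested brackets in the second.\<close>

lemma (in quadratic_mock_pre_Lie_algebra) symplectic_anticommutator:
  "symplectic_mock_Lie_algebra scale (anticommutator prd) \<omega>"
proof
  note prd = prd_bilinear [unfolded bilinear_product_iff]
  show "bilinear_product (anticommutator prd)"
    using prd unfolding bilinear_product_iff anticommutator_def
    by (simp add: algebra_simps scale_right_distrib)
  show sym: "anticommutator prd x y = anticommutator prd y x" for x y
    by (simp add: anticommutator_def add.commute)
  show "anticommutator prd x (anticommutator prd y z) +
      anticommutator prd y (anticommutator prd z x) +
      anticommutator prd z (anticommutator prd x y) = 0" (is "?J = 0") for x y z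
  proof (rule zero_if_form_zero_right)
    fix w
    have "prd (prd x y) w + prd x (prd y w) + (prd (prd y x) w + prd y (prd x w)) = 0"
      using mock_pre_Lie [of x y w]
      by (metis add.commute add.left_inverse diff_conv_add_uminus minus_add)
    then have "prd x (prd y w) + prd y (prd x w) + prd (anticommutator prd x y) w = 0"
      using prd by (simp add: anticommutator_def add_ac)
    \<comment> \<open>Taking \<open>w\<close> as the rightmost factor lets \<open>quadratic\<close>
      strip off the left factors: the terms become \<open>\<omega> w\<close> of {y, {x, z}}, {x, {y,
      z}} and {{x, y}, z}.\<close>
    then have "\<omega> (prd x (prd y w) + prd y (prd x w) + prd (anticommutator prd x y) w) z = 0"
      by simp
    then show "\<omega> w ?J = 0"
      by (simp add: form_add_left form_add_right quadratic sym [of z x]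
          sym [of z "anticommutator prd x y"] add_ac)
  qed
  show "\<omega> (anticommutator prd x y) z + \<omega> (anticommutator prd y z) x
      + \<omega> (anticommutator prd z x) y = 0" for x y z
  proof -
    have "\<omega> (anticommutator prd x y) z
        = \<omega> y (anticommutator prd z x) + \<omega> x (anticommutator prd y z)"
      unfolding anticommutator_def [of prd x y] form_add_left quadratic
      by (simp add: sym [of x z])
    then show ?thesis
      by (simp add: form_skew [of "anticommutator prd y z"] form_skew [of "anticommutator prd z x"])
  qed
qed

text \<open>Left multiplication by x is chosen as the \<omega>-adjoint of bracketing with x. This
  gives surjectivity of the correspondence.\<close>

lemma (in symplectic_mock_Lie_algebra) ex_quadratic_mock_pre_Lie:
  assumes "finite_dimensional_vector_space scale Basis"
  obtains prd where "quadratic_mock_pre_Lie_algebra scale prd \<omega>"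
    and "anticommutator prd = bracket"
proof -
  note bracket = bracket_bilinear [unfolded bilinear_product_iff]
  have "\<exists>v. \<forall>z. \<omega> v z = \<omega> y (bracket x z)" for x y
  proof -
    have "Vector_Spaces.linear scale (*) (\<lambda>z. \<omega> y (bracket x z))"
      using bracket unfolding linear_into_scalars_iff
      by (simp add: form_add_right form_scale_right)
    from linear_functional_represented [OF assms this] show ?thesis by blast
  qed
  then have "\<forall>x y. \<exists>v. \<forall>z. \<omega> v z = \<omega> y (bracket x z)" by blast
  from this [unfolded choice_iff]
  obtain prd where prd: "\<And>x y z. \<omega> (prd x y) z = \<omega> y (bracket x z)"
    by blast
  have anti: "prd x y + prd y x = bracket x y" for x y
  proof (rule eq_if_form_eq_left)
    fix z
    \<comment> \<open>The left side is \<omega>(y, {x, z}) + \<omega>(x, {y, z}); skew-symmetry and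
      the symplectic identity turn it into the right side.\<close>
    show "\<omega> (prd x y + prd y x) z = \<omega> (bracket x y) z"
      using symplectic [of x y z]
      by (simp add: form_add_left prd bracket_sym [of x z] form_skew [of "bracket y z"]
          form_skew [of "bracket z x"] algebra_simps)
  qed
  then have eq: "anticommutator prd = bracket"
    by (intro ext) (simp add: anticommutator_def)
  have bil: "bilinear_product prd"
    unfolding bilinear_product_iff
    by (intro conjI allI; rule eq_if_form_eq_left)
      (use bracket in \<open>simp_all add: prd form_add_left form_scale_left form_add_right
        form_scale_right\<close>)
  have "quadratic_mock_pre_Lie_algebra scale prd \<omega>"
  proof
    show "bilinear_product prd" by (rule bil)
    show "\<omega> (prd x y) z = \<omega> y (anticommutator prd x z)" for x y z
      by (simp add: prd eq)
    show "prd (prd x y) z + prd x (prd y z) = - prd (prd y x) z - prd y (prd x z)" for x y z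
    proof -
      \<comment> \<open>By \<open>anti\<close>, this is the mock-pre-Lie identity with its two
        products of the form (a b) z merged.\<close>
      have "prd (bracket x y) z + prd x (prd y z) + prd y (prd x z) = 0"
      proof (rule form_nondegenerate)
        fix w
        \<comment> \<open>The earlier computation in reverse: Jacobi for x, y and the test vector
          \<open>w\<close>, paired with the rightmost factor \<open>z\<close>.\<close>
        have "\<omega> z (bracket x (bracket y w) + bracket y (bracket w x) + bracket w (bracket x y)) = 0"
          by (simp add: bracket_Jacobi)
        then show "\<omega> (prd (bracket x y) z + prd x (prd y z) + prd y (prd x z)) w = 0"
          by (simp add: form_add_left form_add_right prd bracket_sym [of w x]
              bracket_sym [of w "bracket x y"] add_ac)
      qed
      then show ?thesis
        using bil unfolding bilinear_product_iff anti [symmetric]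
        by (simp add: algebra_simps eq_neg_iff_add_eq_0)
    qed
  qed
  then show thesis using eq by (rule that)
qed

text \<open>Both products pair with z to \<omega>(y, {x, z}), which involves only the shared bracket
  and form.\<close>

lemma quadratic_prd_unique:
  assumes "quadratic_mock_pre_Lie_algebra scale prd \<omega>"
    and "quadratic_mock_pre_Lie_algebra scale prd' \<omega>"
    and "anticommutator prd = anticommutator prd'"
  shows "prd = prd'"
proof (intro ext)
  fix x y
  interpret P: quadratic_mock_pre_Lie_algebra scale prd \<omega> by fact
  interpret P': quadratic_mock_pre_Lie_algebra scale prd' \<omega> by fact
  show "prd x y = prd' x y"
    by (rule P.eq_if_form_eq_left) (simp add: P.quadratic P'.quadratic assms(3))
qed

theorem proposition2p19:
  fixes scale :: "'k::{alg_closed_field, field_char_0} \<Rightarrow> 'v::ab_group_add \<Rightarrow> 'v"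
    and Basis :: "'v set"
  assumes "finite_dimensional_vector_space scale Basis"
  shows "bij_betw (\<lambda>(prd, \<omega>). (anticommutator prd, \<omega>))
           {(prd, \<omega>). quadratic_mock_pre_Lie_algebra scale prd \<omega>}
           {(bracket, \<omega>). symplectic_mock_Lie_algebra scale bracket \<omega>}"
proof (rule bij_betw_imageI)
  \<comment> \<open>The form is carried along unchanged, so uniqueness for one fixed form
    suffices.\<close>
  show "inj_on (\<lambda>(prd, \<omega>). (anticommutator prd, \<omega>))
      {(prd, \<omega>). quadratic_mock_pre_Lie_algebra scale prd \<omega>}"
    by (auto simp: inj_on_def intro: quadratic_prd_unique)
  show "(\<lambda>(prd, \<omega>). (anticommutator prd, \<omega>)) `
      {(prd, \<omega>). quadratic_mock_pre_Lie_algebra scale prd \<omega>} =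
      {(bracket, \<omega>). symplectic_mock_Lie_algebra scale bracket \<omega>}"
  proof (intro set_eqI iffI)
    fix p
    assume "p \<in> {(bracket, \<omega>). symplectic_mock_Lie_algebra scale bracket \<omega>}"
    then obtain bracket \<omega> where p: "p = (bracket, \<omega>)"
      and "symplectic_mock_Lie_algebra scale bracket \<omega>" by blast
    then obtain prd where "quadratic_mock_pre_Lie_algebra scale prd \<omega>"
      and "anticommutator prd = bracket"
      using symplectic_mock_Lie_algebra.ex_quadratic_mock_pre_Lie [OF _ assms] by blast
    then show "p \<in> (\<lambda>(prd, \<omega>). (anticommutator prd, \<omega>)) `
        {(prd, \<omega>). quadratic_mock_pre_Lie_algebra scale prd \<omega>}"
      unfolding p by (intro image_eqI [of _ _ "(prd, \<omega>)"]) simp_all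
  qed (auto intro: quadratic_mock_pre_Lie_algebra.symplectic_anticommutator)
qed

end
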